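(* Let $m\ge 2$ and let $C$ be a Coxeter element in $\mathfrak{S}_{2m-1}$. If $C$ is admissible, then there exists an expression $C=w_1w_2$ with $\ell(w_1)=\ell(w_2)=m-1$ such that $w_2C^{m-1}$ is the longest element of $\mathfrak{S}_{2m-1}$. Conversely, if $w_2C^{m-1}$ is the longest element of $\mathfrak{S}_{2m-1}$ for some expression $C=w_1w_2$ with $\ell(w_1)=\ell(w_2)=m-1$, then $C$ is admissible.
   Context: $\mathfrak{S}_n$ is the symmetric group on $\{1,\dots,n\}$ with generators $s_i=(i,i+1)$, $1\le i\le n-1$; products are composed from right to left. $\ell(w)$ is the minimal number of generators in an expression of $w$; the longest element $w_0$ is the unique element of length $n(n-1)/2$, with $w_0(i)=n+1-i$. A Coxeter element of $\mathfrak{S}_n$ is a product of the $n-1$ generators, each used exactly once, in some order. An expression $C=w_1w_2$ of a Coxeter element $C=s_{i_1}s_{i_2}\cdots s_{i_{2m-2}}$ of $\mathfrak{S}_{2m-1}$ means $w_1=s_{i_1}\cdots s_{i_{m-1}}$, $w_2=s_{i_m}\cdots s_{i_{2m-2}}$ for some way of writing $C$ as a product of the $2m-2$ distinct generators. Height: for a Coxeter element $C$ of $\mathfrak{S}_n$ and $2\le i\le n-1$ put $\epsilon_i=+1$ if $s_i$ occurs to the left of $s_{i-1}$ in the product expressing $C$, and $\epsilon_i=-1$ if it occurs to the right (this depends only on $C$). The height is $ht(C)=\sum_{i=2}^{n-1}\epsilon_i$. Extensions: regard $\mathfrak{S}_{n+2}$ as the permutation group of $\{0,1,\dots,n,n+1\}$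 generated by $s_0=(0,1), s_1=(1,2),\dots,s_n=(n,n+1)$, and $\mathfrak{S}_n$ as the subgroup fixing $0$ and $n+1$. For a Coxeter element $C$ of $\mathfrak{S}_n$, its extensions are the four Coxeter elements $s_0s_nC$, $Cs_0s_n$, $s_0Cs_n$, $s_nCs_0$ of $\mathfrak{S}_{n+2}$. After relabelling letters by $j\mapsto j+1$, these are Coxeter elements of $\mathfrak{S}_{n+2}$ in the usual numbering (and heights are computed accordingly, as the sum of $\epsilon_1,\dots,\epsilon_n$ in the numbering starting from $0$). Admissibility: both Coxeter elements $s_1s_2$ and $s_2s_1$ of $\mathfrak{S}_3$ are admissible. If $C$ is an admissible Coxeter element of $\mathfrak{S}_{2m-1}$ ($m\ge2$), an extension $\mathcal{E}(C)$ of $C$ in $\mathfrak{S}_{2m+1}$ is called admissible if $|ht(\mathcal{E}(C))|\le 1$. The admissible Coxeter elements of $\mathfrak{S}_{2m-1}$ are exactly those obtained from $s_1s_2$ or $s_2s_1$ in $\mathfrak{S}_3$ by iterated admissible extensions (every intermediate extension being admissible). *)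

theory Defs
  imports Main "HOL-Combinatorics.Permutations"
begin

text \<open>
  Elements of the symmetric group on \<open>{1..n}\<close> are functions \<open>nat \<Rightarrow> nat\<close> that permute \<open>{1..n}\<close>
  (and fix everything else), so the smaller symmetric groups are literally subgroups of the larger
  ones. The group operation is composition, which is composition from right to left.
\<close>

definition gen :: "nat \<Rightarrow> nat \<Rightarrow> nat" where
  "gen i = transpose i (i + 1)"

definition word_prod :: "nat list \<Rightarrow> nat \<Rightarrow> nat" where
  "word_prod is = foldr (\<lambda>i w. gen i \<circ> w) is id"

definition len :: "nat \<Rightarrow> (nat \<Rightarrow> nat) \<Rightarrow> nat" where
  "len n w = (LEAST k. \<exists>is. length is = k \<and> set is \<subseteq> {1..<n} \<and> word_prod is = w)"

definition longest_element :: "nat \<Rightarrow> (nat \<Rightarrow> nat) \<Rightarrow> bool" where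
  "longest_element n w \<longleftrightarrow> w permutes {1..n} \<and> len n w = n * (n - 1) div 2"

definition coxeter_word :: "nat \<Rightarrow> nat list \<Rightarrow> bool" where
  "coxeter_word n is \<longleftrightarrow> distinct is \<and> set is = {1..<n}"

definition coxeter_element :: "nat \<Rightarrow> (nat \<Rightarrow> nat) \<Rightarrow> bool" where
  "coxeter_element n C \<longleftrightarrow> (\<exists>is. coxeter_word n is \<and> C = word_prod is)"

definition coxeter_expression :: "nat \<Rightarrow> (nat \<Rightarrow> nat) \<Rightarrow> (nat \<Rightarrow> nat) \<Rightarrow> (nat \<Rightarrow> nat) \<Rightarrow> bool" where
  "coxeter_expression m C w1 w2 \<longleftrightarrow>
     (\<exists>is. coxeter_word (2 * m - 1) is \<and> C = word_prod is \<and>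
           w1 = word_prod (take (m - 1) is) \<and> w2 = word_prod (drop (m - 1) is))"

definition occurs_left :: "'a \<Rightarrow> 'a \<Rightarrow> 'a list \<Rightarrow> bool" where
  "occurs_left x y xs \<longleftrightarrow> (\<exists>p q. p < q \<and> q < length xs \<and> xs ! p = x \<and> xs ! q = y)"

text \<open>
  For a Coxeter element \<open>C\<close> and \<open>2 \<le> i < n\<close>, the relative position of \<open>i\<close> and \<open>i - 1\<close> is the same
  in all Coxeter words expressing \<open>C\<close>, so the existential quantifier could be replaced by a
  universal one.
\<close>

definition eps :: "nat \<Rightarrow> (nat \<Rightarrow> nat) \<Rightarrow> nat \<Rightarrow> int" where
  "eps n C i =
     (if \<exists>is. coxeter_word n is \<and> C = word_prod is \<and> occurs_left i (i - 1) is then 1 else - 1)"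

definition height :: "nat \<Rightarrow> (nat \<Rightarrow> nat) \<Rightarrow> int" where
  "height n C = (\<Sum>i\<in>{2..<n}. eps n C i)"

text \<open>
  Relabelling letters by \<open>j \<mapsto> j + 1\<close> turns permutations of \<open>{0..n + 1}\<close> into permutations of
  \<open>{1..n + 2}\<close>.
\<close>

definition relabel :: "(nat \<Rightarrow> nat) \<Rightarrow> nat \<Rightarrow> nat" where
  "relabel w x = (case x of 0 \<Rightarrow> 0 | Suc j \<Rightarrow> Suc (w j))"

definition extensions :: "nat \<Rightarrow> (nat \<Rightarrow> nat) \<Rightarrow> (nat \<Rightarrow> nat) set" where
  "extensions n C = relabel `
     {gen 0 \<circ> gen n \<circ> C, C \<circ> gen 0 \<circ> gen n, gen 0 \<circ> C \<circ> gen n, gen n \<circ> C \<circ> gen 0}"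

text \<open>\<open>admissible n C\<close> only holds for odd \<open>n \<ge> 3\<close>, i.e. for \<open>n = 2 * m - 1\<close> with \<open>m \<ge> 2\<close>.\<close>

inductive admissible :: "nat \<Rightarrow> (nat \<Rightarrow> nat) \<Rightarrow> bool" where
  base12: "admissible 3 (gen 1 \<circ> gen 2)"
| base21: "admissible 3 (gen 2 \<circ> gen 1)"
| extend: "admissible n C \<Longrightarrow> E \<in> extensions n C \<Longrightarrow> \<bar>height (n + 2) E\<bar> \<le> 1 \<Longrightarrow>
             admissible (n + 2) E"

end

theory Submission
  imports Defs "HOL-Combinatorics.Orbits"
begin

text \<open>
  Write \<open>R\<close> for the longest element, the reversal, and \<open>n = 2m - 1\<close>. Since \<open>C\<close> is an \<open>n\<close>-cycle, an
  expression \<open>C = w\<^sub>1 w\<^sub>2\<close> satisfies \<open>w\<^sub>2 C\<^bsup>m-1\<^esup> = R\<close> iff \<open>w\<^sub>2 = R w\<^sub>1 R\<close>, i.e. iff \<open>C\<close> has a Coxeter word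
  whose second half is obtained from the first by \<open>i \<mapsto> n - i\<close> (a mirror word). In a mirror word,
  \<open>\<epsilon>\<^sub>i + \<epsilon>\<^bsub>n+1-i\<^esub> = 2 (h\<^sub>i - h\<^bsub>i-1\<^esub>)\<close>, where \<open>h\<^sub>i\<close> is 1 or 0 according to whether \<open>s\<^sub>i\<close> lies in the first
  half, so the height telescopes to \<open>h\<^bsub>n-1\<^esub> - h\<^sub>1 = \<plusminus>1\<close>. Removing the outermost generators from a mirror
  word leaves a mirror word, which makes \<open>C\<close> admissible; and of the four extensions of a mirror word
  three are again mirror words, while the fourth has height \<open>\<plusminus>3\<close>.
\<close>

section \<open>Words in the generators\<close>

lemma word_prod_Nil [simp]: "word_prod [] = id"
  by (simp add: word_prod_def)

lemma word_prod_Cons [simp]: "word_prod (i # is) = gen i \<circ> word_prod is"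
  by (simp add: word_prod_def)

lemma word_prod_append [simp]: "word_prod (xs @ ys) = word_prod xs \<circ> word_prod ys"
  by (induction xs) (simp_all add: comp_assoc)

lemma gen_gen [simp]: "gen i (gen i x) = x"
  by (simp add: gen_def)

lemma gen_permutes: "i \<in> {1..<n} \<Longrightarrow> gen i permutes {1..n}"
  unfolding gen_def by (rule permutes_swap_id) auto

lemma word_prod_permutes: "set xs \<subseteq> {1..<n} \<Longrightarrow> word_prod xs permutes {1..n}"
  by (induction xs) (auto simp: permutes_id intro!: permutes_compose gen_permutes simp del: One_nat_def)

lemma bij_gen: "bij (gen i)"
  by (simp add: gen_def)

lemma bij_word_prod: "bij (word_prod xs)"
proof (induction xs)
  case (Cons i xs)
  then show ?case unfolding word_prod_Cons by (rule bij_comp) (rule bij_gen)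
qed (simp only: word_prod_Nil bij_id)

lemma gen_commute:
  assumes "i \<noteq> j + 1" "j \<noteq> i + 1"
  shows "gen i \<circ> gen j = gen j \<circ> gen i"
  using assms by (auto simp: gen_def fun_eq_iff transpose_def)

lemma gen_word_prod_commute:
  assumes "\<And>i. i \<in> set xs \<Longrightarrow> i \<noteq> j + 1 \<and> j \<noteq> i + 1"
  shows "gen j \<circ> word_prod xs = word_prod xs \<circ> gen j"
  using assms
proof (induction xs)
  case (Cons i xs)
  have "gen j (gen i x) = gen i (gen j x)" for x
    using gen_commute[of i j] Cons.prems by (simp add: fun_eq_iff)
  then show ?case using Cons by (simp add: fun_eq_iff)
qed simp

lemma gen_le_iff: "i \<noteq> j \<Longrightarrow> gen j x \<le> i \<longleftrightarrow> x \<le> i"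
  by (auto simp: gen_def transpose_def)

text \<open>Only \<open>gen i\<close> carries points across the cut between \<open>i\<close> and
  \<open>Suc i\<close>. This cut later detects which letters a word contains and in which
  order.\<close>

lemma word_prod_le_iff: "i \<notin> set xs \<Longrightarrow> word_prod xs x \<le> i \<longleftrightarrow> x \<le> i"
  by (induction xs) (auto simp: gen_le_iff)

lemma word_prod_fixes:
  assumes "i \<notin> set xs" "Suc i \<notin> set xs"
  shows "word_prod xs (Suc i) = Suc i"
  using word_prod_le_iff[OF assms(1), of "Suc i"] word_prod_le_iff[OF assms(2), of "Suc i"] by simp

text \<open>A word without \<open>i\<close> preserves \<open>{..i}\<close>, whereas a word
  containing \<open>i\<close> exactly once carries some point of \<open>{..i}\<close> across the
  cut.\<close>

lemma generator_occurs:
  assumes "distinct xs" "i \<in> set xs" "word_prod ys = word_prod xs"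
  shows "i \<in> set ys"
proof (rule ccontr)
  assume ys: "i \<notin> set ys"
  obtain p q where xs: "xs = p @ i # q" using assms(2) by (meson split_list)
  then have "i \<notin> set p" "i \<notin> set q" using assms(1) by auto
  \<comment> \<open>\<open>x\<close> is the point that sits at \<open>i\<close> just before the
    single letter \<open>i\<close> acts.\<close>
  obtain x where x: "word_prod q x = i" using bij_word_prod[of q] by (metis bij_pointE)
  then have "x \<le> i" using word_prod_le_iff[OF \<open>i \<notin> set q\<close>, of x] by simp
  have "word_prod xs x = word_prod p (Suc i)" by (simp add: xs x gen_def)
  then have "\<not> word_prod xs x \<le> i" using word_prod_le_iff[OF \<open>i \<notin> set p\<close>, of "Suc i"] by simp
  then show False using word_prod_le_iff[OF ys, of x] \<open>x \<le> i\<close> assms(3) by simp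
qed

lemma word_prod_set_eq:
  assumes "distinct xs" "distinct ys" "word_prod xs = word_prod ys"
  shows "set xs = set ys"
  using generator_occurs assms by (metis subset_antisym subsetI)

text \<open>By \<open>generator_occurs\<close>, any word for the same element contains all letters
  of \<open>xs\<close>, so it cannot be shorter.\<close>

lemma len_word_prod_distinct:
  assumes "distinct xs" "set xs \<subseteq> {1..<n}"
  shows "len n (word_prod xs) = length xs"
  unfolding len_def
proof (rule Least_equality)
  show "\<exists>is. length is = length xs \<and> set is \<subseteq> {1..<n} \<and> word_prod is = word_prod xs"
    using assms by blast
next
  fix k assume "\<exists>is. length is = k \<and> set is \<subseteq> {1..<n} \<and> word_prod is = word_prod xs"
  then obtain ys where "length ys = k" "word_prod ys = word_prod xs" by blast
  moreover have "set xs \<subseteq> set ys" using generator_occurs assms(1) calculation(2) by blast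
  then have "card (set xs) \<le> card (set ys)" by (simp add: card_mono)
  ultimately show "length xs \<le> k"
    using assms(1) card_length[of ys] distinct_card[of xs] by linarith
qed

text \<open>Since \<open>k\<close> is the only possible neighbour of \<open>j\<close> and occurs at
  most once, it is missing on one side of \<open>j\<close>, and \<open>j\<close> commutes out
  through that side. This serves for the outermost generators, which have a single
  neighbour.\<close>

lemma word_prod_extract:
  assumes "distinct xs" "j \<in> set xs" "\<And>i. i \<in> set xs \<Longrightarrow> i = j + 1 \<or> j = i + 1 \<Longrightarrow> i = k"
  shows "word_prod xs = gen j \<circ> word_prod (filter (\<lambda>x. x \<noteq> j) xs) \<or>
         word_prod xs = word_prod (filter (\<lambda>x. x \<noteq> j) xs) \<circ> gen j"
proof -
  obtain p q where xs: "xs = p @ j # q" using assms(2) by (meson split_list)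
  then have "j \<notin> set p" "j \<notin> set q" using assms(1) by auto
  then have "filter (\<lambda>x. x \<noteq> j) p = p" "filter (\<lambda>x. x \<noteq> j) q = q"
    by (auto simp: filter_id_conv)
  then have f: "filter (\<lambda>x. x \<noteq> j) xs = p @ q" by (simp add: xs)
  consider "k \<notin> set p" | "k \<notin> set q" using assms(1) by (auto simp: xs)
  then show ?thesis
  proof cases
    case 1
    then have "gen j \<circ> word_prod p = word_prod p \<circ> gen j"
      using assms(3) by (intro gen_word_prod_commute) (auto simp: xs)
    then have "word_prod xs = gen j \<circ> word_prod (p @ q)" by (simp add: xs comp_assoc[symmetric])
    then show ?thesis by (simp only: f) simp
  next
    case 2
    then have "gen j \<circ> word_prod q = word_prod q \<circ> gen j"
      using assms(3) by (intro gen_word_prod_commute) (auto simp: xs)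
    then have "word_prod xs = word_prod (p @ q) \<circ> gen j" by (simp add: xs comp_assoc)
    then show ?thesis by (simp only: f) simp
  qed
qed

section \<open>The longest element\<close>

definition reversal :: "nat \<Rightarrow> nat \<Rightarrow> nat" where
  "reversal n x = (if x \<in> {1..n} then n + 1 - x else x)"

lemma reversal_reversal [simp]: "reversal n (reversal n x) = x"
  by (auto simp: reversal_def)

lemma reversal_comp_reversal [simp]: "reversal n \<circ> reversal n = id"
  by (simp add: fun_eq_iff)

lemma reversal_permutes: "reversal n permutes {1..n}"
proof (rule bij_imp_permutes)
  show "bij_betw (reversal n) {1..n} {1..n}"
    by (rule bij_betwI[where g = "reversal n"]) (auto simp: reversal_def)
qed (auto simp: reversal_def)

lemma reversal_conj_gen:
  assumes "i \<in> {1..<n}"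
  shows "reversal n \<circ> gen i \<circ> reversal n = gen (n - i)"
proof
  fix x
  consider "x = n - i" | "x = Suc (n - i)" | "x \<noteq> n - i" "x \<noteq> Suc (n - i)" by blast
  then show "(reversal n \<circ> gen i \<circ> reversal n) x = gen (n - i) x"
  proof cases
    case 3
    then have "reversal n x \<noteq> i" "reversal n x \<noteq> Suc i"
      using assms by (auto simp: reversal_def)
    then have "gen i (reversal n x) = reversal n x" by (simp add: gen_def)
    then show ?thesis using 3 by (simp add: gen_def)
  qed (use assms in \<open>auto simp: gen_def reversal_def\<close>)
qed

lemma reversal_conj_word_prod:
  assumes "set xs \<subseteq> {1..<n}"
  shows "reversal n \<circ> word_prod xs \<circ> reversal n = word_prod (map (\<lambda>x. n - x) xs)"
  using assms
proof (induction xs)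
  case (Cons i xs)
  have "reversal n (gen i (reversal n x)) = gen (n - i) x" for x
    using reversal_conj_gen[of i n] Cons.prems by (simp add: fun_eq_iff)
  then have "reversal n (gen i x) = gen (n - i) (reversal n x)" for x
    by (metis reversal_reversal)
  then show ?case using Cons by (simp add: fun_eq_iff)
qed (simp add: fun_eq_iff)

section \<open>Length as the number of inversions\<close>

definition pairs :: "nat \<Rightarrow> (nat \<times> nat) set" where
  "pairs n = {(i, j). 1 \<le> i \<and> i < j \<and> j \<le> n}"

definition inversions :: "nat \<Rightarrow> (nat \<Rightarrow> nat) \<Rightarrow> (nat \<times> nat) set" where
  "inversions n w = {(i, j) \<in> pairs n. w j < w i}"

lemma finite_pairs [simp]: "finite (pairs n)"
  by (rule finite_subset[of _ "{1..n} \<times> {1..n}"]) (auto simp: pairs_def)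

lemma card_pairs: "card (pairs n) = n * (n - 1) div 2"
proof (induction n)
  case 0
  have "pairs 0 = {}" by (auto simp: pairs_def)
  then show ?case by simp
next
  case (Suc n)
  have *: "pairs (Suc n) = pairs n \<union> (\<lambda>i. (i, Suc n)) ` {1..n}"
    by (auto simp: pairs_def)
  have "card (pairs (Suc n)) = card (pairs n) + n"
  proof -
    have "pairs n \<inter> (\<lambda>i. (i, Suc n)) ` {1..n} = {}" by (auto simp: pairs_def)
    then show ?thesis unfolding * by (subst card_Un_disjoint) (auto simp: card_image inj_on_def)
  qed
  also have "\<dots> = Suc n * (Suc n - 1) div 2"
    unfolding Suc by (cases n) (simp_all add: algebra_simps)
  finally show ?case .
qed

lemma inversions_subset: "inversions n w \<subseteq> pairs n"
  by (auto simp: inversions_def)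

lemma finite_inversions [simp]: "finite (inversions n w)"
  using finite_subset[OF inversions_subset] by simp

text \<open>Composing with \<open>gen k\<close> on the left exchanges the values \<open>k\<close>
  and \<open>Suc k\<close>, so only the pair of positions holding these two values can become a new
  inversion.\<close>

lemma card_inversions_word_prod: "card (inversions n (word_prod xs)) \<le> length xs"
proof (induction xs)
  case Nil
  have "inversions n id = {}" by (auto simp: inversions_def pairs_def)
  then show ?case by (simp add: id_def)
next
  case (Cons k xs)
  define w where "w = word_prod xs"
  obtain a b where ab: "w a = k" "w b = Suc k"
    using bij_word_prod[of xs] unfolding w_def by (metis bij_pointE)
  have inj: "w x = w y \<longleftrightarrow> x = y" for x y
    using bij_word_prod[of xs] by (simp add: w_def bij_def inj_eq)
  have "inversions n (gen k \<circ> w) \<subseteq> insert (a, b) (inversions n w)"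
  proof
    fix z assume "z \<in> inversions n (gen k \<circ> w)"
    then obtain i j where z: "z = (i, j)" "(i, j) \<in> pairs n" "gen k (w j) < gen k (w i)"
      by (auto simp: inversions_def)
    show "z \<in> insert (a, b) (inversions n w)"
    proof (cases "w j < w i")
      case False
      then have "w i = k" "w j = Suc k"
        using z by (auto simp: gen_def transpose_def split: if_splits)
      then have "i = a" "j = b" using inj[of i a] inj[of j b] ab by simp_all
      then show ?thesis using z by simp
    qed (use z in \<open>auto simp: inversions_def\<close>)
  qed
  then have "card (inversions n (gen k \<circ> w)) \<le> card (insert (a, b) (inversions n w))"
    by (rule card_mono[rotated]) simp
  also have "\<dots> \<le> Suc (card (inversions n w))"
    by (simp add: card_insert_if)
  finally have "card (inversions n (gen k \<circ> w)) \<le> Suc (card (inversions n w))" .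
  then show ?case using Cons unfolding w_def by (simp add: comp_def)
qed

text \<open>Induction upwards gives \<open>k \<le> f k\<close>, and induction downwards from
  \<open>n\<close> gives the opposite inequality.\<close>

lemma permutes_mono_imp_id:
  assumes "f permutes {1..n}" "\<And>k. k \<in> {1..<n} \<Longrightarrow> f k < f (Suc k)"
  shows "f = id"
proof -
  have ge: "k \<le> f k" if "k \<le> n" for k
    using that
  proof (induction k)
    case (Suc k)
    have "f (Suc k) \<in> {1..n}" using Suc permutes_in_image[OF assms(1), of "Suc k"] by simp
    moreover have "f k < f (Suc k)" if "k \<noteq> 0" using that Suc assms(2)[of k] by simp
    ultimately show ?case using Suc by (cases "k = 0") auto
  qed simp
  have le: "f (n - k) \<le> n - k" if "k < n" for k
    using that
  proof (induction k)
    case 0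
    then show ?case using permutes_in_image[OF assms(1), of n] by auto
  next
    case (Suc k)
    then have "f (n - Suc k) < f (Suc (n - Suc k))" by (intro assms(2)) auto
    moreover have "Suc (n - Suc k) = n - k" using Suc by simp
    ultimately have "f (n - Suc k) < n - k" using Suc by simp
    then show ?case by linarith
  qed
  have "f x = x" for x
  proof (cases "x \<in> {1..n}")
    case True
    then show ?thesis using ge[of x] le[of "n - x"] by simp
  qed (use assms(1) in \<open>simp add: permutes_not_in\<close>)
  then show ?thesis by (simp add: fun_eq_iff)
qed

text \<open>This is sorting by adjacent values: unless \<open>w\<close> is the identity, some value
  \<open>Suc k\<close> stands before \<open>k\<close>, and composing with \<open>gen k\<close>
  removes exactly one inversion.\<close>

lemma word_of_length_inversions:
  assumes "w permutes {1..n}"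
  shows "\<exists>xs. set xs \<subseteq> {1..<n} \<and> word_prod xs = w \<and> length xs = card (inversions n w)"
  using assms
proof (induction "card (inversions n w)" arbitrary: w rule: less_induct)
  case less
  show ?case
  proof (cases "w = id")
    case True
    have "inversions n id = {}" by (auto simp: inversions_def pairs_def)
    then show ?thesis using True by (intro exI[of _ "[]"]) simp
  next
    case False
    have pinv: "inv w permutes {1..n}" using less.prems by (rule permutes_inv)
    have "inv w \<noteq> id" using False less.prems by (metis inv_id permutes_inv_inv)
    then obtain k where k: "k \<in> {1..<n}" "\<not> inv w k < inv w (Suc k)"
      using permutes_mono_imp_id[OF pinv] by blast
    \<comment> \<open>These are the positions of the values \<open>k\<close> and
      \<open>Suc k\<close>; \<open>(a, b)\<close> is the inversion to be removed.\<close>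
    define b a where "b = inv w k" and "a = inv w (Suc k)"
    have wab: "w b = k" "w a = Suc k"
      using less.prems by (simp_all add: a_def b_def permutes_inverses)
    then have "a < b" using k(2) by (metis a_def b_def linorder_neqE_nat n_not_Suc_n)
    moreover have "a \<in> {1..n}" "b \<in> {1..n}"
      using k(1) permutes_in_image[OF pinv] by (auto simp: a_def b_def)
    ultimately have ab: "(a, b) \<in> pairs n" by (simp add: pairs_def)
    have inj: "w x = w y \<longleftrightarrow> x = y" for x y
      using permutes_inj[OF less.prems] by (simp add: inj_eq)
    define v where "v = gen k \<circ> w"
    have inv_v: "inversions n w = insert (a, b) (inversions n v)" "(a, b) \<notin> inversions n v"
    proof -
      show "(a, b) \<notin> inversions n v"
        using wab by (simp add: v_def inversions_def gen_def)
      have "w j < w i \<longleftrightarrow> i = a \<and> j = b \<or> gen k (w j) < gen k (w i)" if "i < j" for i j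
      proof -
        have "w i = k \<longleftrightarrow> i = b" "w j = k \<longleftrightarrow> j = b" "w i = Suc k \<longleftrightarrow> i = a" "w j = Suc k \<longleftrightarrow> j = a"
          using inj wab by metis+
        then show ?thesis using that \<open>a < b\<close>
          by (auto simp: gen_def transpose_def)
      qed
      then show "inversions n w = insert (a, b) (inversions n v)"
        using ab by (auto simp: inversions_def v_def pairs_def)
    qed
    then have card: "card (inversions n w) = Suc (card (inversions n v))" by simp
    have "v permutes {1..n}"
      unfolding v_def using less.prems gen_permutes[OF k(1)] by (rule permutes_compose)
    then obtain xs where xs: "set xs \<subseteq> {1..<n}" "word_prod xs = v" "length xs = card (inversions n v)"
      using less.hyps[of v] card by auto
    have "word_prod (k # xs) = w" by (simp add: xs v_def fun_eq_iff)
    then show ?thesis using xs k(1) card by (intro exI[of _ "k # xs"]) auto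
  qed
qed

lemma len_eq_card_inversions:
  assumes "w permutes {1..n}"
  shows "len n w = card (inversions n w)"
  unfolding len_def
proof (rule Least_equality)
  show "\<exists>is. length is = card (inversions n w) \<and> set is \<subseteq> {1..<n} \<and> word_prod is = w"
    using word_of_length_inversions[OF assms] by blast
qed (use card_inversions_word_prod in blast)

text \<open>Length \<open>n * (n - 1) div 2\<close> forces every pair to be an inversion. Then
  \<open>w\<close> is decreasing on \<open>{1..n}\<close>, so its composition with the reversal is
  increasing and hence the identity.\<close>

lemma longest_element_iff: "longest_element n w \<longleftrightarrow> w = reversal n"
proof
  assume w: "longest_element n w"
  then have p: "w permutes {1..n}" by (simp add: longest_element_def)
  have "card (inversions n w) = card (pairs n)"
    using w len_eq_card_inversions[OF p] by (simp add: longest_element_def card_pairs)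
  then have all: "inversions n w = pairs n"
    using inversions_subset finite_pairs by (metis card_subset_eq)
  have "reversal n \<circ> w = id"
  proof (rule permutes_mono_imp_id)
    show "reversal n \<circ> w permutes {1..n}" using p reversal_permutes by (rule permutes_compose)
    fix k assume k: "k \<in> {1..<n}"
    then have "(k, Suc k) \<in> inversions n w" by (simp add: all pairs_def)
    then have "w (Suc k) < w k" by (simp add: inversions_def)
    moreover have "w k \<in> {1..n}" "w (Suc k) \<in> {1..n}"
      using k permutes_in_image[OF p] by auto
    ultimately show "(reversal n \<circ> w) k < (reversal n \<circ> w) (Suc k)"
      by (auto simp: reversal_def)
  qed
  then have "reversal n \<circ> (reversal n \<circ> w) = reversal n" by simp
  then show "w = reversal n" by (simp add: comp_assoc[symmetric])
next
  assume w: "w = reversal n"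
  have "inversions n (reversal n) = pairs n"
    by (auto simp: inversions_def pairs_def reversal_def)
  then show "longest_element n w"
    using len_eq_card_inversions[OF reversal_permutes]
    by (simp add: w longest_element_def reversal_permutes card_pairs del: One_nat_def)
qed

section \<open>Coxeter elements are full cycles\<close>

text \<open>If \<open>f\<close> is invariant under \<open>s\<^sub>i w\<close> and \<open>w\<close> preserves \<open>{..i}\<close>, then comparing the sums of \<open>f\<close>
  and of \<open>f \<circ> s\<^sub>i \<circ> w\<close> over \<open>{..i}\<close> gives \<open>f i = f (i + 1)\<close>.\<close>
lemma invariant_under_word_prod:
  fixes f :: "nat \<Rightarrow> int"
  assumes "f \<circ> word_prod xs = f" "distinct xs" "i \<in> set xs"
  shows "f (Suc i) = f i"
  using assms
proof (induction xs)
  case (Cons k xs)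
  have "bij_betw (word_prod xs) {..k} {..k}"
    unfolding bij_betw_def
  proof
    show "inj_on (word_prod xs) {..k}" using bij_word_prod[of xs] by (meson bij_def inj_on_subset subset_UNIV)
    have k: "k \<notin> set xs" using Cons.prems by simp
    show "word_prod xs ` {..k} = {..k}"
    proof (intro equalityI subsetI)
      fix y assume "y \<in> {..k}"
      moreover obtain x where "y = word_prod xs x" using bij_word_prod[of xs] by (metis bij_pointE)
      ultimately show "y \<in> word_prod xs ` {..k}" using word_prod_le_iff[OF k] by auto
    qed (use word_prod_le_iff[OF k] in auto)
  qed
  then have "(\<Sum>x\<le>k. f (gen k (word_prod xs x))) = (\<Sum>x\<le>k. f (gen k x))"
    by (rule sum.reindex_bij_betw)
  moreover have "f (gen k (word_prod xs x)) = f x" for x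
    using Cons.prems(1) by (simp add: fun_eq_iff)
  moreover have "(\<Sum>x<k. f (gen k x)) = (\<Sum>x<k. f x)"
    by (rule sum.cong) (auto simp: gen_def transpose_def)
  moreover have "{..k} = insert k {..<k}" by auto
  ultimately have fk: "f (Suc k) = f k" by (simp add: gen_def)
  \<comment> \<open>As \<open>f\<close> is now invariant under \<open>gen k\<close> too, the first
    letter cancels and the induction hypothesis applies to the tail.\<close>
  then have "f (gen k x) = f x" for x by (simp add: gen_def transpose_def)
  then have "f \<circ> word_prod xs = f" using Cons.prems(1) by (simp add: fun_eq_iff)
  then show ?case using Cons fk by auto
qed simp

text \<open>The indicator function of \<open>A\<close> is invariant, and every generator occurs in
  the word, so the indicator agrees at all neighbouring points of \<open>{1..n}\<close>.\<close>

lemma coxeter_invariant_set: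
  assumes "coxeter_word n xs" "\<And>x. word_prod xs x \<in> A \<longleftrightarrow> x \<in> A" "a \<in> A" "a \<in> {1..n}"
  shows "{1..n} \<subseteq> A"
proof
  define f :: "nat \<Rightarrow> int" where "f x = (if x \<in> A then 1 else 0)" for x
  have f: "f (Suc i) = f i" if "i \<in> {1..<n}" for i
    using that assms by (intro invariant_under_word_prod[of f xs]) (auto simp: f_def coxeter_word_def)
  have c: "f x = f 1" if "x \<in> {1..n}" for x
    using that
  proof (induction x)
    case (Suc x)
    then show ?case using f[of x] by (cases "x = 0") auto
  qed simp
  fix x assume "x \<in> {1..n}"
  then have "f x = f a" using c assms(4) by metis
  then show "x \<in> A" using assms(3) by (simp add: f_def split: if_splits)
qed

lemma coxeter_orbit:
  assumes "coxeter_word n xs" "a \<in> {1..n}"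
  shows "orbit (word_prod xs) a = {1..n}"
proof
  have p: "word_prod xs permutes {1..n}"
    using assms by (intro word_prod_permutes) (simp add: coxeter_word_def)
  have "permutation (word_prod xs)" using p by (auto simp: permutation_permutes)
  then have a: "a \<in> orbit (word_prod xs) a" by (rule permutation_self_in_orbit)
  have "(word_prod xs x \<in> orbit (word_prod xs) a) = (x \<in> orbit (word_prod xs) a)" for x
    using \<open>permutation (word_prod xs)\<close>
    by (metis orbit.step permutation_orbit_step orbit_cyclic_eq3 permutation_self_in_orbit cyclic_on_def orbit_step)
  then show "{1..n} \<subseteq> orbit (word_prod xs) a"
    using coxeter_invariant_set[OF assms(1) _ a assms(2)] by blast
  show "orbit (word_prod xs) a \<subseteq> {1..n}"
    using assms(2) p by (meson permutes_orbit_subset)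
qed

lemma permutes_funpow_not_in:
  assumes "p permutes S" "x \<notin> S"
  shows "(p ^^ k) x = x"
  using assms by (induction k) (simp_all add: permutes_not_in)

lemma coxeter_funpow_id:
  assumes "coxeter_word n xs"
  shows "word_prod xs ^^ n = id"
proof
  fix x
  define C where "C = word_prod xs"
  show "(word_prod xs ^^ n) x = id x"
  proof (cases "x \<in> {1..n}")
    case True
    then have o: "orbit C x = {1..n}" unfolding C_def by (rule coxeter_orbit[OF assms])
    with True have x: "x \<in> orbit C x" by simp
    \<comment> \<open>The iterates before the first return to \<open>x\<close> are distinct and fill
      the orbit, so the return time is the orbit size \<open>n\<close>.\<close>
    have "card (orbit C x) = funpow_dist1 C x x"
      using orbit_conv_funpow_dist1[OF x] inj_on_funpow_dist1[OF x] by (metis card_image card_atLeastLessThan diff_zero)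
    then have "funpow_dist1 C x x = n" by (simp add: o)
    then show ?thesis using funpow_dist1_prop[OF x] by (simp add: C_def)
  next
    case False
    have "word_prod xs permutes {1..n}"
      using assms by (intro word_prod_permutes) (simp add: coxeter_word_def)
    then show ?thesis using permutes_funpow_not_in[OF _ False] by simp
  qed
qed

text \<open>By transitivity some power of the Coxeter element agrees with \<open>g\<close> at
  \<open>1\<close>. The set where the two agree is invariant, because both commute with the Coxeter
  element, so it contains \<open>{1..n}\<close>.\<close>

lemma coxeter_centralizer:
  assumes "coxeter_word n xs" "g permutes {1..n}" "g \<circ> word_prod xs = word_prod xs \<circ> g" "n \<ge> 1"
  shows "\<exists>k. g = word_prod xs ^^ k"
proof -
  define C where "C = word_prod xs"
  have C: "C permutes {1..n}"
    unfolding C_def using assms by (intro word_prod_permutes) (simp add: coxeter_word_def)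
  have gC: "g (C x) = C (g x)" for x using assms(3) by (simp add: C_def fun_eq_iff)
  have "g 1 \<in> orbit C 1"
    unfolding C_def using assms coxeter_orbit[OF assms(1), of 1] permutes_in_image[OF assms(2)] by simp
  then obtain k where k: "g 1 = (C ^^ k) 1" by (auto simp: orbit_altdef)
  define A where "A = {x. g x = (C ^^ k) x}"
  have "C x \<in> A \<longleftrightarrow> x \<in> A" for x
    using permutes_inj[OF C] by (simp add: A_def gC funpow_swap1[symmetric] inj_eq)
  then have "{1..n} \<subseteq> A"
    using k assms(4) unfolding C_def
    by (intro coxeter_invariant_set[OF assms(1), of A 1]) (simp_all add: A_def C_def)
  then have "g x = (C ^^ k) x" for x
    using permutes_not_in[OF assms(2), of x] permutes_funpow_not_in[OF C, of x k]
    by (cases "x \<in> {1..n}") (auto simp: A_def)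
  then show ?thesis by (auto simp: C_def)
qed

text \<open>With \<open>R\<close> the reversal and \<open>g = w\<^sub>1 R\<close>, the right-hand side says \<open>g\<^sup>2 = C\<close>. Then \<open>g\<close> is a
  power of the \<open>n\<close>-cycle \<open>C\<close>, so that \<open>g\<^sup>n = 1\<close> and \<open>w\<^sub>2 C\<^bsup>m-1\<^esup> = R g\<^bsup>2m-1\<^esup> = R\<close>.\<close>
lemma half_product_eq_reversal_iff:
  assumes "coxeter_word n (us @ vs)" "n = 2 * m - 1" "m \<ge> 1"
  shows "word_prod vs \<circ> word_prod (us @ vs) ^^ (m - 1) = reversal n \<longleftrightarrow>
         reversal n \<circ> word_prod us \<circ> reversal n = word_prod vs"
proof -
  define a b C R where "a = word_prod us" and "b = word_prod vs"
    and "C = word_prod (us @ vs)" and "R = reversal n"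
  have C: "C = a \<circ> b" by (simp add: a_def b_def C_def)
  have Cn: "C ^^ n = id" unfolding C_def using assms(1) by (rule coxeter_funpow_id)
  have R: "R \<circ> R = id" by (simp add: R_def)
  have a: "a permutes {1..n}"
    unfolding a_def using assms(1) by (intro word_prod_permutes) (auto simp: coxeter_word_def)
  define g where "g = a \<circ> R"
  have "b \<circ> C ^^ (m - 1) = R \<longleftrightarrow> R \<circ> a \<circ> R = b"
  proof
    assume *: "b \<circ> C ^^ (m - 1) = R"
    \<comment> \<open>Composing the hypothesis with \<open>a\<close> on the left gives
      \<open>C ^^ m = g\<close>. Since \<open>2 * m = n + 1\<close> and \<open>C ^^ n = id\<close>,
      squaring yields \<open>g \<circ> g = C\<close>, and cancelling \<open>a\<close> gives the
      claim.\<close>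
    have "C ^^ m = C \<circ> C ^^ (m - 1)" using assms(3) by (cases m) simp_all
    also have "\<dots> = a \<circ> (b \<circ> C ^^ (m - 1))" by (simp add: C comp_assoc)
    finally have g: "C ^^ m = g" by (simp only: * g_def)
    have "g \<circ> g = C ^^ (m + m)" unfolding g[symmetric] by (rule funpow_add[symmetric])
    also have "m + m = Suc n" using assms(2,3) by simp
    also have "C ^^ Suc n = C" by (simp only: funpow.simps Cn comp_id)
    finally have "g \<circ> g = C" .
    then have "a (R (a (R x))) = a (b x)" for x by (simp add: g_def C fun_eq_iff)
    then show "R \<circ> a \<circ> R = b" using permutes_inj[OF a] by (simp add: fun_eq_iff inj_eq)
  next
    assume *: "R \<circ> a \<circ> R = b"
    then have g2: "g ^^ 2 = C"
      by (simp add: g_def C *[symmetric] numeral_2_eq_2 comp_assoc)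
    then have gC: "g \<circ> C = C \<circ> g" by (simp add: numeral_2_eq_2 comp_assoc[symmetric] flip: g2)
    have "g permutes {1..n}"
      unfolding g_def R_def using reversal_permutes a by (rule permutes_compose)
    moreover have "n \<ge> 1" using assms(2,3) by simp
    ultimately obtain k where "g = C ^^ k"
      using coxeter_centralizer[OF assms(1) _ gC[unfolded C_def]] unfolding C_def by blast
    then have "g ^^ n = (C ^^ n) ^^ k" by (simp add: funpow_mult mult.commute)
    then have gn: "g ^^ n = id" by (simp add: Cn)
    have "g ^^ n = g ^^ Suc (2 * (m - 1))"
      using assms(2,3) by (intro arg_cong[where f = "\<lambda>k. g ^^ k"]) auto
    also have "\<dots> = g \<circ> C ^^ (m - 1)" by (simp add: funpow_mult flip: g2)
    finally have "R \<circ> (g \<circ> C ^^ (m - 1)) = R" by (simp add: gn)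
    then show "b \<circ> C ^^ (m - 1) = R" by (simp add: *[symmetric] g_def comp_assoc)
  qed
  then show ?thesis by (simp only: a_def b_def C_def R_def)
qed

section \<open>Signs and heights\<close>

lemma filter_eq_pairD:
  assumes "filter P xs = [a, b]"
  obtains p q r where "xs = p @ a # q @ b # r" "\<forall>x \<in> set (p @ q @ r). \<not> P x"
proof -
  obtain p ys where p: "xs = p @ a # ys" "\<forall>x \<in> set p. \<not> P x" "filter P ys = [b]"
    using filter_eq_ConsD[OF assms] by metis
  obtain q r where q: "ys = q @ b # r" "\<forall>x \<in> set q. \<not> P x" "filter P r = []"
    using filter_eq_ConsD[OF p(3)] by metis
  have "\<forall>x \<in> set (p @ q @ r). \<not> P x"
    using p(2) q(2) q(3) unfolding filter_empty_conv by auto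
  then show thesis using that p(1) unfolding q(1) by blast
qed

lemma occurs_left_appendI: "occurs_left a b (p @ a # q @ b # r)"
  unfolding occurs_left_def
  by (intro exI[of _ "length p"] exI[of _ "length p + 1 + length q"]) (simp add: nth_append)

lemma occurs_left_if_filter:
  assumes "filter P xs = [a, b]"
  shows "occurs_left a b xs"
  using assms by (rule filter_eq_pairD) (simp only: occurs_left_appendI)

lemma occurs_left_asym:
  assumes "distinct xs" "occurs_left a b xs"
  shows "\<not> occurs_left b a xs"
proof
  assume "occurs_left b a xs"
  then obtain p q where pq: "p < q" "q < length xs" "xs ! p = b" "xs ! q = a"
    by (auto simp: occurs_left_def)
  obtain p' q' where pq': "p' < q'" "q' < length xs" "xs ! p' = a" "xs ! q' = b"
    using assms(2) by (auto simp: occurs_left_def)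
  have "p < length xs" "p' < length xs" using pq pq' by linarith+
  moreover have "xs ! p = xs ! q'" "xs ! q = xs ! p'" by (simp_all only: pq pq')
  ultimately have "p = q'" "q = p'"
    using nth_eq_iff_index_eq[OF assms(1)] pq(2) pq'(2) by blast+
  then show False using pq(1) pq'(1) by simp
qed

lemma distinct_set_singleton:
  assumes "distinct ys" "set ys = {a}"
  shows "ys = [a]"
proof -
  have "length ys = Suc 0" using assms distinct_card[OF assms(1)] by simp
  then obtain y where "ys = [y]" by (auto simp: length_Suc_conv)
  then show ?thesis using assms(2) by simp
qed

lemma distinct_set_pair:
  assumes "distinct ys" "set ys = {a, b}" "a \<noteq> b"
  shows "ys = [a, b] \<or> ys = [b, a]"
proof -
  have "length ys = Suc (Suc 0)" using assms distinct_card[OF assms(1)] by simp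
  then obtain x y where "ys = [x, y]" by (auto simp: length_Suc_conv)
  then show ?thesis using assms by auto
qed

text \<open>For a Coxeter word and adjacent generators this is one of two lists, recording which of
  them comes first. Unlike positions, it behaves well under append and map.\<close>

abbreviation restrict_pair :: "nat \<Rightarrow> nat list \<Rightarrow> nat list" where
  "restrict_pair i \<equiv> filter (\<lambda>x. x = i \<or> x = Suc i)"

lemma restrict_pair_cases:
  assumes "distinct xs" "i \<in> set xs" "Suc i \<in> set xs"
  shows "restrict_pair i xs = [Suc i, i] \<or> restrict_pair i xs = [i, Suc i]"
  using assms by (intro distinct_set_pair) auto

lemma restrict_pair_singleton:
  assumes "distinct xs"
  shows "i \<in> set xs \<Longrightarrow> Suc i \<notin> set xs \<Longrightarrow> restrict_pair i xs = [i]"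
    and "i \<notin> set xs \<Longrightarrow> Suc i \<in> set xs \<Longrightarrow> restrict_pair i xs = [Suc i]"
    and "i \<notin> set xs \<Longrightarrow> Suc i \<notin> set xs \<Longrightarrow> restrict_pair i xs = []"
proof -
  show "i \<in> set xs \<Longrightarrow> Suc i \<notin> set xs \<Longrightarrow> restrict_pair i xs = [i]"
    and "i \<notin> set xs \<Longrightarrow> Suc i \<in> set xs \<Longrightarrow> restrict_pair i xs = [Suc i]"
    using assms by (auto intro!: distinct_set_singleton)
qed (auto simp: filter_empty_conv)

text \<open>Together with its counterpart for the opposite order, this reads the sign off the
  permutation alone: the letter acting first on \<open>Suc i\<close> moves it to \<open>i\<close> or
  to \<open>i + 2\<close>, and the remaining letters cannot bring it back across the relevant
  cut.\<close>

lemma word_prod_le_if_restrict_pair: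
  assumes "restrict_pair i xs = [Suc i, i]"
  shows "word_prod xs (Suc i) \<le> i"
  using assms
proof (rule filter_eq_pairD)
  fix p q r
  assume xs: "xs = p @ Suc i # q @ i # r" and "\<forall>x \<in> set (p @ q @ r). \<not> (x = i \<or> x = Suc i)"
  then have n: "i \<notin> set p" "i \<notin> set q" "i \<notin> set r" "Suc i \<notin> set r" by auto
  have "word_prod xs (Suc i) = word_prod p (gen (Suc i) (word_prod q i))"
    using word_prod_fixes[OF n(3,4)] by (simp add: xs gen_def)
  then show ?thesis using n by (simp add: word_prod_le_iff gen_le_iff)
qed

lemma word_prod_gt_if_restrict_pair:
  assumes "restrict_pair i xs = [i, Suc i]"
  shows "\<not> word_prod xs (Suc i) \<le> i"
  using assms
proof (rule filter_eq_pairD)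
  fix p q r
  assume xs: "xs = p @ i # q @ Suc i # r" and "\<forall>x \<in> set (p @ q @ r). \<not> (x = i \<or> x = Suc i)"
  then have n: "Suc i \<notin> set p" "Suc i \<notin> set q" "i \<notin> set r" "Suc i \<notin> set r" by auto
  have "word_prod xs (Suc i) = word_prod p (gen i (word_prod q (Suc (Suc i))))"
    using word_prod_fixes[OF n(3,4)] by (simp add: xs gen_def)
  then have "\<not> word_prod xs (Suc i) \<le> Suc i" using n by (simp add: word_prod_le_iff gen_le_iff)
  then show ?thesis by simp
qed

text \<open>The sign depends only on the permutation, by the two preceding tests, so the existential
  in \<open>eps\<close> can be evaluated on any given Coxeter word.\<close>

lemma eps_word_prod:
  assumes "coxeter_word n xs" "1 \<le> i" "Suc i < n"
  shows "eps n (word_prod xs) (Suc i) = (if restrict_pair i xs = [Suc i, i] then 1 else - 1)"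
proof -
  have cases: "restrict_pair i ys = [Suc i, i] \<or> restrict_pair i ys = [i, Suc i]"
    if "coxeter_word n ys" for ys
    using that assms by (intro restrict_pair_cases) (auto simp: coxeter_word_def)
  have left: "occurs_left (Suc i) i ys \<longleftrightarrow> restrict_pair i ys = [Suc i, i]" if "coxeter_word n ys" for ys
  proof
    assume o: "occurs_left (Suc i) i ys"
    then have "\<not> occurs_left i (Suc i) ys"
      using that by (intro occurs_left_asym) (simp_all add: coxeter_word_def)
    then have "restrict_pair i ys \<noteq> [i, Suc i]"
      using occurs_left_if_filter[of "\<lambda>x. x = i \<or> x = Suc i" ys i "Suc i"] by blast
    then show "restrict_pair i ys = [Suc i, i]" using cases[OF that] by blast
  qed (rule occurs_left_if_filter)
  have "(\<exists>ys. coxeter_word n ys \<and> word_prod xs = word_prod ys \<and> occurs_left (Suc i) i ys) \<longleftrightarrow>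
        restrict_pair i xs = [Suc i, i]"
  proof
    assume "\<exists>ys. coxeter_word n ys \<and> word_prod xs = word_prod ys \<and> occurs_left (Suc i) i ys"
    then obtain ys where ys: "restrict_pair i ys = [Suc i, i]" "word_prod xs = word_prod ys"
      using left by blast
    have "word_prod xs (Suc i) \<le> i"
      unfolding ys(2) using ys(1) by (rule word_prod_le_if_restrict_pair)
    then have "restrict_pair i xs \<noteq> [i, Suc i]" using word_prod_gt_if_restrict_pair by blast
    then show "restrict_pair i xs = [Suc i, i]" using cases[OF assms(1)] by blast
  qed (use left[OF assms(1)] assms(1) in blast)
  then show ?thesis by (simp add: eps_def)
qed

lemma height_word_prod:
  assumes "coxeter_word n xs" "n \<ge> 2"
  shows "height n (word_prod xs) =
         (\<Sum>i = 1..<n - 1. if restrict_pair i xs = [Suc i, i] then 1 else - 1)"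
proof -
  have "{2..<n} = {Suc 1..<Suc (n - 1)}" using assms(2) by auto
  then have "height n (word_prod xs) = (\<Sum>i = 1..<n - 1. eps n (word_prod xs) (Suc i))"
    unfolding height_def by (simp only: sum.shift_bounds_Suc_ivl)
  also have "\<dots> = (\<Sum>i = 1..<n - 1. if restrict_pair i xs = [Suc i, i] then 1 else - 1)"
    using assms by (intro sum.cong refl eps_word_prod) auto
  finally show ?thesis .
qed

section \<open>Mirror words\<close>

definition mirror_word :: "nat \<Rightarrow> nat list \<Rightarrow> nat list" where
  "mirror_word n us = us @ map (\<lambda>x. n - x) us"

text \<open>The two halves of a Coxeter word are disjoint and together contain every letter; the
  reflection exchanges them.\<close>

lemma mirror_word_mem_iff:
  assumes "coxeter_word n (mirror_word n us)" "i \<in> {1..<n}"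
  shows "n - i \<in> set us \<longleftrightarrow> i \<notin> set us"
proof
  assume "n - i \<in> set us"
  then have "n - (n - i) \<in> (\<lambda>x. n - x) ` set us" by (rule imageI)
  then show "i \<notin> set us" using assms by (auto simp: mirror_word_def coxeter_word_def)
next
  assume "i \<notin> set us"
  moreover have "i \<in> set us \<union> (\<lambda>x. n - x) ` set us"
    using assms by (simp add: mirror_word_def coxeter_word_def)
  ultimately obtain x where "x \<in> set us" "i = n - x" by auto
  moreover have "x \<in> {1..<n}"
    using calculation(1) assms(1) by (auto simp: mirror_word_def coxeter_word_def)
  ultimately show "n - i \<in> set us" by simp
qed

lemma height_mirror_word:
  assumes "coxeter_word n (mirror_word n us)" "n \<ge> 2"
  shows "height n (word_prod (mirror_word n us)) =
         of_bool (n - 1 \<in> set us) - of_bool (1 \<in> set us)"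
proof -
  define e :: "nat \<Rightarrow> int" where
    "e i = (if restrict_pair i (mirror_word n us) = [Suc i, i] then 1 else - 1)" for i
  define h :: "nat \<Rightarrow> int" where "h i = of_bool (i \<in> set us)" for i
  have d: "distinct us" and us: "set us \<subseteq> {1..<n}"
    using assms by (auto simp: mirror_word_def coxeter_word_def)
  have restrict: "restrict_pair i (mirror_word n us) =
      restrict_pair i us @ map (\<lambda>x. n - x) (restrict_pair (n - Suc i) us)" if "i \<in> {1..<n - 1}" for i
  proof -
    have "filter (\<lambda>x. n - x = i \<or> n - x = Suc i) us = restrict_pair (n - Suc i) us"
      using us that by (intro filter_cong) auto
    then show ?thesis by (simp add: mirror_word_def filter_map comp_def)
  qed
  \<comment> \<open>\<open>e i\<close> is the sign at \<open>Suc i\<close>, so pairing the signs at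
    \<open>i\<close> and \<open>n + 1 - i\<close> becomes pairing the indices \<open>i\<close> and
    \<open>n - 1 - i\<close>.\<close>
  have sym: "e i + e (n - 1 - i) = 2 * (h (Suc i) - h i)" if i: "i \<in> {1..<n - 1}" for i
  proof -
    define j where "j = n - Suc i"
    have j: "j \<in> {1..<n - 1}" "n - Suc j = i" "n - j = Suc i" "n - i = Suc j" "n - Suc i = j"
      using i by (auto simp: j_def)
    have mem: "j \<in> set us \<longleftrightarrow> Suc i \<notin> set us" "Suc j \<in> set us \<longleftrightarrow> i \<notin> set us"
    proof -
      have "i \<in> {1..<n}" "Suc i \<in> {1..<n}" using i by auto
      then show "j \<in> set us \<longleftrightarrow> Suc i \<notin> set us" "Suc j \<in> set us \<longleftrightarrow> i \<notin> set us"
        using mirror_word_mem_iff[OF assms(1)] j(4,5) by metis+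
    qed
    note r = restrict[OF i] restrict[OF j(1)]
    \<comment> \<open>If \<open>i\<close> and \<open>Suc i\<close> lie in the same half, the
      reflected pair has the opposite sign and the sum vanishes. If they lie in different halves,
      both signs equal \<open>h (Suc i) - h i\<close>.\<close>
    have *: "e i + e j = 2 * (h (Suc i) - h i)"
    proof (cases "i \<in> set us"; cases "Suc i \<in> set us")
      assume "i \<in> set us" "Suc i \<in> set us"
      then show ?thesis
        using restrict_pair_cases[OF d, of i] restrict_pair_singleton[OF d, of j] mem
        by (auto simp: e_def h_def r j)
    next
      assume "i \<notin> set us" "Suc i \<notin> set us"
      then show ?thesis
        using restrict_pair_cases[OF d, of j] restrict_pair_singleton[OF d, of i] mem
        by (auto simp: e_def h_def r j)
    qed (use restrict_pair_singleton[OF d, of i] restrict_pair_singleton[OF d, of j] mem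
          in \<open>auto simp: e_def h_def r j\<close>)
    then show ?thesis by (simp add: j_def)
  qed
  have "(\<Sum>i = 1..<n - 1. e (n - 1 - i)) = (\<Sum>i = 1..<n - 1. e i)"
    by (rule sum.reindex_bij_witness[of _ "\<lambda>i. n - 1 - i" "\<lambda>i. n - 1 - i"]) auto
  then have "2 * (\<Sum>i = 1..<n - 1. e i) = (\<Sum>i = 1..<n - 1. e i + e (n - 1 - i))"
    by (simp add: sum.distrib)
  also have "\<dots> = 2 * (\<Sum>i = 1..<n - 1. h (Suc i) - h i)"
    unfolding sum_distrib_left by (intro sum.cong refl sym)
  also have "\<dots> = 2 * (h (n - 1) - h 1)"
    using assms(2) by (subst sum_Suc_diff') auto
  finally show ?thesis
    using height_word_prod[OF assms] by (simp add: e_def h_def)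
qed

section \<open>Admissibility\<close>

lemma relabel_comp: "relabel (f \<circ> g) = relabel f \<circ> relabel g"
  by (auto simp: relabel_def fun_eq_iff split: nat.split)

lemma relabel_gen: "relabel (gen i) = gen (Suc i)"
  by (auto simp: relabel_def fun_eq_iff gen_def transpose_def split: nat.split)

lemma relabel_word_prod: "relabel (word_prod xs) = word_prod (map Suc xs)"
proof (induction xs)
  case Nil
  show ?case by (auto simp: relabel_def fun_eq_iff split: nat.split)
next
  case (Cons i xs)
  then show ?case
    by (simp only: word_prod_Cons relabel_comp relabel_gen list.map)
qed

lemma extensions_word_prod:
  fixes n xs
  defines "W \<equiv> word_prod (map Suc xs)"
  shows "extensions n (word_prod xs) =
    {gen 1 \<circ> gen (n + 1) \<circ> W, W \<circ> gen 1 \<circ> gen (n + 1), gen 1 \<circ> W \<circ> gen (n + 1), gen (n + 1) \<circ> W \<circ> gen 1}"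
  by (simp add: extensions_def relabel_comp relabel_gen relabel_word_prod W_def)

text \<open>Each of the letters \<open>1\<close> and \<open>n + 1\<close> has one neighbour, so both
  can be pulled to the ends of the product; what remains is a shifted word in the smaller
  group.\<close>

lemma word_prod_in_extensions:
  assumes "coxeter_word (n + 2) xs" "n \<ge> 2"
  shows "word_prod xs \<in>
    extensions n (word_prod (map (\<lambda>x. x - 1) (filter (\<lambda>x. x \<noteq> 1 \<and> x \<noteq> n + 1) xs)))"
proof -
  define ys zs where "ys = filter (\<lambda>x. x \<noteq> 1) xs" and "zs = filter (\<lambda>x. x \<noteq> n + 1) ys"
  have xs: "distinct xs" "set xs = {1..<n + 2}" using assms by (simp_all add: coxeter_word_def)
  have zs: "filter (\<lambda>x. x \<noteq> 1 \<and> x \<noteq> n + 1) xs = zs" by (simp add: ys_def zs_def conj_commute)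
  have "map (Suc \<circ> (\<lambda>x. x - 1)) zs = map id zs"
    using xs by (intro map_cong) (auto simp: ys_def zs_def)
  then have Suc: "map Suc (map (\<lambda>x. x - 1) zs) = zs" by simp
  have X: "word_prod xs = gen 1 \<circ> word_prod ys \<or> word_prod xs = word_prod ys \<circ> gen 1"
    unfolding ys_def by (rule word_prod_extract[where k = 2]) (use xs in auto)
  have Y: "word_prod ys = gen (n + 1) \<circ> word_prod zs \<or> word_prod ys = word_prod zs \<circ> gen (n + 1)"
    unfolding zs_def
    by (rule word_prod_extract[where k = n]) (use xs assms(2) in \<open>auto simp: ys_def\<close>)
  have "gen 1 \<circ> gen (n + 1) = gen (n + 1) \<circ> gen 1" by (rule gen_commute) (use assms(2) in auto)
  then have "word_prod zs \<circ> gen (n + 1) \<circ> gen 1 = word_prod zs \<circ> gen 1 \<circ> gen (n + 1)"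
    by (simp add: comp_assoc)
  with X Y show ?thesis unfolding zs extensions_word_prod Suc by (auto simp only: comp_assoc)
qed

lemma admissible_mirror_word:
  assumes "coxeter_word (2 * k + 3) (mirror_word (2 * k + 3) us)"
  shows "admissible (2 * k + 3) (word_prod (mirror_word (2 * k + 3) us))"
  using assms
proof (induction k arbitrary: us)
  case 0
  then have d: "distinct (mirror_word 3 us)" and s: "set (mirror_word 3 us) = {1..<3}"
    by (simp_all add: coxeter_word_def)
  have "length (mirror_word 3 us) = 2" using distinct_card[OF d] s by simp
  then have "length us = Suc 0" by (simp add: mirror_word_def)
  then obtain a where us: "us = [a]" by (auto simp: length_Suc_conv)
  then have "a \<in> {1..<3}" using s by (auto simp: mirror_word_def)
  then have "a = 1 \<or> a = 2" by auto
  then have "word_prod (mirror_word 3 us) \<in> {gen 1 \<circ> gen 2, gen 2 \<circ> gen 1}"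
    by (auto simp: us mirror_word_def)
  then have "admissible 3 (word_prod (mirror_word 3 us))"
    by (elim insertE emptyE) (simp_all only: base12 base21)
  then show ?case by simp
next
  case (Suc k)
  define n where "n = 2 * k + 3"
  define P where "P = (\<lambda>x. x \<noteq> 1 \<and> x \<noteq> n + 1)"
  define vs where "vs = map (\<lambda>x. x - 1) (filter P us)"
  have n: "2 * Suc k + 3 = n + 2" by (simp add: n_def)
  note cw = Suc.prems[unfolded n]
  have d: "distinct (mirror_word (n + 2) us)" and s: "set (mirror_word (n + 2) us) = {1..<n + 2}"
    using cw by (simp_all add: coxeter_word_def)
  have us: "x \<in> {1..<n + 2}" if "x \<in> set us" for x
    using that s by (auto simp: mirror_word_def)
  \<comment> \<open>The reflection in size \<open>n + 2\<close> exchanges \<open>1\<close> and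
    \<open>n + 1\<close>, so deleting these letters respects the mirror structure. Lowering the
    other letters by one turns it into the reflection in size \<open>n\<close>.\<close>
  have "filter (\<lambda>x. P (n + 2 - x)) us = filter P us"
    using us by (intro filter_cong) (auto simp: P_def)
  then have restrict: "map (\<lambda>x. x - 1) (filter P (mirror_word (n + 2) us)) = mirror_word n vs"
    using us by (auto simp: mirror_word_def vs_def filter_map comp_def P_def)
  have "coxeter_word n (mirror_word n vs)"
    unfolding coxeter_word_def restrict[symmetric]
  proof
    have "inj_on (\<lambda>x. x - 1) {1..<n + 2}" by (auto simp: inj_on_def)
    then have "inj_on (\<lambda>x. x - 1) (set (filter P (mirror_word (n + 2) us)))"
      by (rule inj_on_subset) (unfold set_filter s, blast)
    then show "distinct (map (\<lambda>x. x - 1) (filter P (mirror_word (n + 2) us)))"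
      unfolding distinct_map using d by (simp only: distinct_filter)
    have image: "{x \<in> {1..<n + 2}. P x} = Suc ` {1..<n}"
      unfolding image_Suc_atLeastLessThan P_def by auto
    have "(\<lambda>x. x - 1) ` Suc ` {1..<n} = {1..<n}" unfolding image_image by simp
    then show "set (map (\<lambda>x. x - 1) (filter P (mirror_word (n + 2) us))) = {1..<n}"
      unfolding set_map set_filter s image .
  qed
  then have "admissible n (word_prod (mirror_word n vs))"
    unfolding n_def by (rule Suc.IH)
  moreover have "word_prod (mirror_word (n + 2) us) \<in> extensions n (word_prod (mirror_word n vs))"
    unfolding restrict[symmetric] P_def
    by (rule word_prod_in_extensions[OF cw]) (simp add: n_def)
  moreover have "\<bar>height (n + 2) (word_prod (mirror_word (n + 2) us))\<bar> \<le> 1"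
    using height_mirror_word[OF cw] by (simp add: of_bool_def)
  ultimately have "admissible (n + 2) (word_prod (mirror_word (n + 2) us))"
    by (rule admissible.extend)
  then show ?case unfolding n .
qed

text \<open>The old signs are merely shifted. In these two extensions the new generators stand at
  opposite ends of the word, which makes both new signs equal.\<close>

lemma height_extension:
  assumes "coxeter_word n xs" "n \<ge> 3" "coxeter_word (n + 2) ys"
    and ys: "ys = 1 # map Suc xs @ [n + 1] \<and> \<delta> = - 2 \<or> ys = (n + 1) # map Suc xs @ [1] \<and> \<delta> = 2"
  shows "height (n + 2) (word_prod ys) = height n (word_prod xs) + \<delta>"
proof -
  define e :: "nat \<Rightarrow> nat list \<Rightarrow> int" where
    "e i zs = (if restrict_pair i zs = [Suc i, i] then 1 else - 1)" for i zs
  have xs: "distinct xs" "set xs = {1..<n}" using assms by (simp_all add: coxeter_word_def)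
  have shift: "e (Suc i) ys = e i xs" if "i \<in> {1..<n - 1}" for i
  proof -
    have "restrict_pair (Suc i) ys = map Suc (restrict_pair i xs)"
      using that ys by (auto simp: filter_map comp_def)
    then show ?thesis by (auto simp: e_def)
  qed
  \<comment> \<open>Letter \<open>0\<close> does not occur in \<open>xs\<close>, so the restriction
    isolates letter \<open>1\<close>, which becomes the neighbour \<open>2\<close> of the new first
    generator. The other end is treated in the same way.\<close>
  have "map Suc (restrict_pair 0 xs) = [2]"
    using restrict_pair_singleton(2)[OF xs(1), of 0] xs(2) assms(2) by simp
  then have "restrict_pair 1 (map Suc xs) = [2]"
    by (simp add: filter_map comp_def)
  moreover have "map Suc (restrict_pair (n - 1) xs) = [n]"
    using restrict_pair_singleton(1)[OF xs(1), of "n - 1"] xs(2) assms(2) by simp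
  then have "restrict_pair n (map Suc xs) = [n]"
    using assms(2) by (cases n) (simp_all add: filter_map comp_def)
  ultimately have ends: "e 1 ys + e n ys = \<delta>"
    using ys assms(2) by (auto simp: e_def)
  have "height (n + 2) (word_prod ys) = (\<Sum>i = 1..<Suc n. e i ys)"
    using height_word_prod[OF assms(3)] by (simp add: e_def)
  also have "\<dots> = e 1 ys + (\<Sum>i = Suc 1..<Suc (n - 1). e i ys) + e n ys"
    using assms(2) by (simp add: sum.atLeast_Suc_lessThan)
  also have "(\<Sum>i = Suc 1..<Suc (n - 1). e i ys) = (\<Sum>i = 1..<n - 1. e i xs)"
    unfolding sum.shift_bounds_Suc_ivl by (intro sum.cong refl shift)
  also have "\<dots> = height n (word_prod xs)"
    using height_word_prod[OF assms(1)] assms(2) by (simp add: e_def)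
  finally show ?thesis using ends by simp
qed

text \<open>This is the induction step for admissible elements: three extensions are rewritten as
  mirror words, and the height bound rules out the fourth.\<close>

lemma extension_mirror_word:
  assumes cw: "coxeter_word n (mirror_word n us)" and "n \<ge> 3"
    and E: "E \<in> extensions n (word_prod (mirror_word n us))" "\<bar>height (n + 2) E\<bar> \<le> 1"
  shows "\<exists>us'. coxeter_word (n + 2) (mirror_word (n + 2) us') \<and> E = word_prod (mirror_word (n + 2) us')"
proof -
  define U V W where "U = map Suc us" and "V = map Suc (map (\<lambda>x. n - x) us)"
    and "W = word_prod (U @ V)"
  \<comment> \<open>\<open>a\<close> is the new generator whose neighbour lies in the first half
    \<open>U\<close>, and \<open>b\<close> is its mirror image, with neighbour in \<open>V\<close>.
    Hence \<open>a\<close> commutes with \<open>V\<close> and \<open>b\<close> with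
    \<open>U\<close>.\<close>
  define a b where "a = (if 1 \<in> set us then 1 else n + 1)" and "b = n + 2 - a"
  have W: "map Suc (mirror_word n us) = U @ V" by (simp add: mirror_word_def U_def V_def)
  have d: "distinct (mirror_word n us)" and s: "set (mirror_word n us) = {1..<n}"
    using cw by (simp_all add: coxeter_word_def)
  have dUV: "distinct (U @ V)" unfolding W[symmetric] using d by (simp add: distinct_map)
  have sUV: "set (U @ V) = {2..<n + 1}"
    unfolding W[symmetric] set_map s image_Suc_atLeastLessThan by (simp add: numeral_2_eq_2)
  have ab: "a = 1 \<and> b = n + 1 \<or> a = n + 1 \<and> b = 1" by (simp add: a_def b_def)
  have ba: "n + 2 - b = a" using ab by auto
  have mem: "1 \<in> set us \<longleftrightarrow> n - 1 \<notin> set us"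
    using mirror_word_mem_iff[OF cw, of 1] assms(2) by simp
  have us: "x < n" if "x \<in> set us" for x
    using that s by (auto simp: mirror_word_def)
  have UV: "map (\<lambda>x. n + 2 - x) U = V"
    by (simp add: U_def V_def Suc_diff_le less_imp_le us)
  have a': "i \<in> set U" if "i = a + 1 \<or> a = i + 1" "i \<in> {2..<n + 1}" for i
  proof -
    have "i - 1 \<in> set us" using that mem by (auto simp: a_def split: if_splits)
    then have "Suc (i - 1) \<in> set U" by (simp add: U_def)
    then show ?thesis using that by simp
  qed
  have b': "i \<in> set V" if "i = b + 1 \<or> b = i + 1" "i \<in> {2..<n + 1}" for i
  proof -
    have "n + 2 - i \<in> set U" using that ab by (intro a') auto
    then have "n + 2 - (n + 2 - i) \<in> set V" unfolding UV[symmetric] by auto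
    then show ?thesis using that by simp
  qed
  have aV: "gen a \<circ> word_prod V = word_prod V \<circ> gen a"
  proof (rule gen_word_prod_commute)
    fix i assume "i \<in> set V"
    then have "i \<in> {2..<n + 1}" "i \<notin> set U" using dUV sUV by auto
    then show "i \<noteq> a + 1 \<and> a \<noteq> i + 1" using a' by blast
  qed
  have bU: "gen b \<circ> word_prod U = word_prod U \<circ> gen b"
  proof (rule gen_word_prod_commute)
    fix i assume "i \<in> set U"
    then have "i \<in> {2..<n + 1}" "i \<notin> set V" using dUV sUV by auto
    then show "i \<noteq> b + 1 \<and> b \<noteq> i + 1" using b' by blast
  qed
  have gab: "gen a \<circ> gen b = gen b \<circ> gen a"
    using ab assms(2) by (intro gen_commute) auto
  have aV': "gen a (word_prod V x) = word_prod V (gen a x)"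
    and bU': "gen b (word_prod U x) = word_prod U (gen b x)" for x
    using aV bU by (simp_all add: fun_eq_iff)
  have E': "E \<in> {gen a \<circ> gen b \<circ> W, W \<circ> gen a \<circ> gen b, gen b \<circ> W \<circ> gen a, gen a \<circ> W \<circ> gen b}"
  proof -
    \<comment> \<open>Which of \<open>a\<close> and \<open>b\<close> is \<open>1\<close> is unknown,
      so both orders of the outer generators are listed first and then merged by
      commutation.\<close>
    have "E \<in> {gen a \<circ> gen b \<circ> W, W \<circ> gen a \<circ> gen b, gen b \<circ> W \<circ> gen a, gen a \<circ> W \<circ> gen b,
        gen b \<circ> gen a \<circ> W, W \<circ> gen b \<circ> gen a}"
      using E(1) ab unfolding extensions_word_prod W W_def[symmetric] by (elim disjE conjE) blast+
    moreover have "gen b \<circ> gen a \<circ> W = gen a \<circ> gen b \<circ> W" by (simp only: gab)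
    moreover have "W \<circ> gen b \<circ> gen a = W \<circ> gen a \<circ> gen b" by (simp only: comp_assoc gab)
    ultimately show ?thesis by (simp only: insert_iff empty_iff) blast
  qed
  have coxeter: "coxeter_word (n + 2) ys" if "mset ys = mset (a # b # U @ V)" for ys
  proof -
    have "distinct (a # b # U @ V)" using dUV sUV ab assms(2) by auto
    moreover have "insert a (insert b {2..<n + 1}) = {1..<n + 2}" using ab by auto
    then have "set (a # b # U @ V) = {1..<n + 2}" by (simp only: list.set sUV)
    ultimately show ?thesis
      unfolding coxeter_word_def
      by (simp only: mset_eq_setD[OF that] mset_eq_imp_distinct_iff[OF that])
  qed
  from E' show ?thesis
  proof (elim insertE emptyE)
    assume 1: "E = gen a \<circ> gen b \<circ> W"
    have "mirror_word (n + 2) (a # U) = a # U @ b # V"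
      by (simp only: mirror_word_def list.map UV b_def append_Cons)
    moreover have "word_prod (a # U @ b # V) = E"
      using bU' by (simp add: 1 W_def fun_eq_iff)
    moreover have "coxeter_word (n + 2) (a # U @ b # V)" by (rule coxeter) simp
    ultimately show ?thesis by metis
  next
    assume 2: "E = W \<circ> gen a \<circ> gen b"
    have "mirror_word (n + 2) (U @ [a]) = U @ a # V @ [b]"
      by (simp only: mirror_word_def list.map map_append UV b_def append_Cons append_Nil append_assoc)
    moreover have "word_prod (U @ a # V @ [b]) = E"
      using aV' by (simp add: 2 W_def fun_eq_iff)
    moreover have "coxeter_word (n + 2) (U @ a # V @ [b])" by (rule coxeter) simp
    ultimately show ?thesis by metis
  next
    assume 3: "E = gen b \<circ> W \<circ> gen a"
    have "mirror_word (n + 2) (b # U) = b # U @ a # V"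
      by (simp only: mirror_word_def list.map UV ba append_Cons)
    moreover have "word_prod (b # U @ a # V) = E"
      using aV' by (simp add: 3 W_def fun_eq_iff)
    moreover have "coxeter_word (n + 2) (b # U @ a # V)" by (rule coxeter) simp
    ultimately show ?thesis by metis
  next
    \<comment> \<open>Here the two new signs agree with the sign of the old height:
      \<open>-1\<close> drops to \<open>-3\<close>, or \<open>1\<close> rises to \<open>3\<close>,
      against the bound.\<close>
    assume 4: "E = gen a \<circ> W \<circ> gen b"
    define ys where "ys = a # map Suc (mirror_word n us) @ [b]"
    have "word_prod ys = E" by (simp add: 4 ys_def W W_def comp_assoc)
    moreover have "height (n + 2) (word_prod ys) =
        height n (word_prod (mirror_word n us)) + (if 1 \<in> set us then - 2 else 2)"
      using assms(2) by (intro height_extension cw coxeter) (auto simp: ys_def W a_def b_def)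
    ultimately show ?thesis
      using E(2) height_mirror_word[OF cw] mem assms(2) by (auto split: if_splits)
  qed
qed

text \<open>The bound \<open>n \<ge> 3\<close> is carried through the induction because
  \<open>extension_mirror_word\<close> needs it.\<close>

lemma admissible_imp_mirror_word:
  assumes "admissible n C"
  shows "n \<ge> 3 \<and> (\<exists>us. coxeter_word n (mirror_word n us) \<and> C = word_prod (mirror_word n us))"
  using assms
proof induction
  case base12
  show ?case by (intro conjI exI[of _ "[1]"]) (auto simp: mirror_word_def coxeter_word_def)
next
  case base21
  show ?case by (intro conjI exI[of _ "[2]"]) (auto simp: mirror_word_def coxeter_word_def)
next
  case (extend n C E)
  then show ?case using extension_mirror_word[of n] by fastforce
qed

section \<open>Mirror words link admissibility with the longest element\<close>

theorem mainTheorem2: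
  fixes m :: nat and C :: "nat \<Rightarrow> nat"
  assumes "m \<ge> 2" and "coxeter_element (2 * m - 1) C"
  shows "(admissible (2 * m - 1) C \<longrightarrow>
            (\<exists>w1 w2. coxeter_expression m C w1 w2 \<and>
               len (2 * m - 1) w1 = m - 1 \<and> len (2 * m - 1) w2 = m - 1 \<and>
               longest_element (2 * m - 1) (w2 \<circ> C ^^ (m - 1)))) \<and>
         (\<forall>w1 w2. coxeter_expression m C w1 w2 \<and>
               len (2 * m - 1) w1 = m - 1 \<and> len (2 * m - 1) w2 = m - 1 \<and>
               longest_element (2 * m - 1) (w2 \<circ> C ^^ (m - 1)) \<longrightarrow>
            admissible (2 * m - 1) C)"
proof (intro conjI impI allI)
  define n where "n = 2 * m - 1"
  have n: "n = 2 * m - 1" "n \<ge> 3" "m \<ge> 1" using assms(1) by (auto simp: n_def)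
  {
    assume "admissible (2 * m - 1) C"
    then obtain us where us: "coxeter_word n (mirror_word n us)" "C = word_prod (mirror_word n us)"
      using admissible_imp_mirror_word unfolding n_def by blast
    define vs where "vs = map (\<lambda>x. n - x) us"
    have cw: "coxeter_word n (us @ vs)" and C: "C = word_prod (us @ vs)"
      using us by (simp_all only: mirror_word_def vs_def)
    then have d: "distinct us" "distinct vs" "set us \<subseteq> {1..<n}" "set vs \<subseteq> {1..<n}"
      by (auto simp: coxeter_word_def)
    \<comment> \<open>The halves of a mirror word have equal length, and together they use
      \<open>n - 1 = 2 * (m - 1)\<close> letters.\<close>
    have "length (us @ vs) = card {1..<n}"
      using cw distinct_card[of "us @ vs"] by (simp add: coxeter_word_def)
    then have length: "length us = m - 1" "length vs = m - 1" using n by (auto simp: vs_def)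
    have "reversal n \<circ> word_prod us \<circ> reversal n = word_prod vs"
      unfolding vs_def using d(3) by (rule reversal_conj_word_prod)
    then have "word_prod vs \<circ> C ^^ (m - 1) = reversal n"
      unfolding C by (rule half_product_eq_reversal_iff[OF cw n(1,3), THEN iffD2])
    moreover have "coxeter_expression m C (word_prod us) (word_prod vs)"
      unfolding coxeter_expression_def using cw length
      by (intro exI[of _ "us @ vs"]) (simp add: n_def C)
    ultimately show "\<exists>w1 w2. coxeter_expression m C w1 w2 \<and>
        len (2 * m - 1) w1 = m - 1 \<and> len (2 * m - 1) w2 = m - 1 \<and>
        longest_element (2 * m - 1) (w2 \<circ> C ^^ (m - 1))"
      using len_word_prod_distinct[OF d(1,3)] len_word_prod_distinct[OF d(2,4)] length
      unfolding longest_element_iff n_def[symmetric]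
      by (intro exI[of _ "word_prod us"] exI[of _ "word_prod vs"] conjI) simp_all
  }
  fix w1 w2
  assume "coxeter_expression m C w1 w2 \<and>
      len (2 * m - 1) w1 = m - 1 \<and> len (2 * m - 1) w2 = m - 1 \<and>
      longest_element (2 * m - 1) (w2 \<circ> C ^^ (m - 1))"
  then obtain ws where ws: "coxeter_word n ws" "C = word_prod ws"
      and w: "w2 = word_prod (drop (m - 1) ws)" "w2 \<circ> C ^^ (m - 1) = reversal n"
    unfolding coxeter_expression_def longest_element_iff n_def[symmetric] by blast
  define us vs where "us = take (m - 1) ws" and "vs = drop (m - 1) ws"
  have ws_eq: "ws = us @ vs" by (simp add: us_def vs_def)
  have cw: "coxeter_word n (us @ vs)" using ws(1) unfolding ws_eq .
  then have us: "distinct us" "set us \<subseteq> {1..<n}" by (auto simp: coxeter_word_def)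
  have "reversal n \<circ> word_prod us \<circ> reversal n = word_prod vs"
    using w unfolding ws(2) ws_eq[symmetric] vs_def[symmetric]
    by (intro half_product_eq_reversal_iff[OF cw n(1,3), THEN iffD1]) (simp only: ws_eq[symmetric])
  \<comment> \<open>The second half agrees with the mirrored first half as a permutation, though
    perhaps not as a list. Equal products of distinct letters use the same letters, so the
    replacement is again a Coxeter word for \<open>C\<close>.\<close>
  then have vs: "word_prod (map (\<lambda>x. n - x) us) = word_prod vs"
    using reversal_conj_word_prod[OF us(2)] by simp
  have d: "distinct (map (\<lambda>x. n - x) us)"
  proof -
    have "inj_on (\<lambda>x. n - x) {1..<n}" by (auto simp: inj_on_def)
    then show ?thesis using us by (simp add: distinct_map inj_on_subset)
  qed
  then have "set (map (\<lambda>x. n - x) us) = set vs"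
    using cw vs by (intro word_prod_set_eq) (auto simp: coxeter_word_def)
  then have "coxeter_word n (mirror_word n us)"
    using cw d by (simp add: coxeter_word_def mirror_word_def)
  moreover have "C = word_prod (mirror_word n us)"
    by (simp add: ws(2) ws_eq mirror_word_def vs)
  moreover have "n = 2 * (m - 2) + 3" using n by simp
  ultimately show "admissible (2 * m - 1) C"
    using admissible_mirror_word[of "m - 2" us] by (simp add: n_def)
qed

end
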